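(* Any two first order autonomous scalar ordinary differential equations are (locally) web equivalent: let $I,J\subseteq\mathbb{R}$ be open intervals and let $f:I\to\mathbb{R}$, $F:J\to\mathbb{R}$ be smooth nowhere vanishing functions. Then for all $(t_0,x_0)\in\mathbb{R}\times I$ and $(T_0,X_0)\in\mathbb{R}\times J$ there is a web equivalence $\Phi$ from the equation $dx/dt=f(x)$, restricted to some open neighbourhood of $(t_0,x_0)$, to the equation $dX/dT=F(X)$, restricted to some open neighbourhood of $(T_0,X_0)$, with $\Phi(t_0,x_0)=(T_0,X_0)$.
   Context: For open neighbourhoods $U$ of $(t_0,x_0)$ in $\mathbb{R}\times I$ and $V$ of $(T_0,X_0)$ in $\mathbb{R}\times J$, a web equivalence from $dx/dt=f(x)$ on $U$ to $dX/dT=F(X)$ on $V$ is a diffeomorphism $\Phi:U\to V$ of the form $\Phi(t,x)=(\varphi_0(t),\varphi_1(x))$, with $\varphi_0,\varphi_1$ smooth functions of one variable, such that $\Phi^*(dX-F\,dT)=a\,(dx-f\,dt)$ for some nowhere vanishing smooth function $a$ on $U$ (that is, $\Phi$ maps integral curves of the first equation to integral curves of the second). *)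

theory Defs
  imports "HOL-Analysis.Analysis"
begin

text \<open>
  \<open>Ck_on k S f\<close>: \<open>f\<close> is of class \<open>C^k\<close> on \<open>S\<close>. Only meaningful for open \<open>S\<close>: derivatives are
  full ones (\<open>at x\<close>, not \<open>at x within S\<close>), and they depend only on \<open>f\<close> restricted to \<open>S\<close>
  because \<open>S\<close> is open. Iterated derivatives are taken as directional derivatives in all directions \<open>v\<close>,
  which in finite dimension agrees with the usual notion.
\<close>

primrec Ck_on :: "nat \<Rightarrow> 'a::euclidean_space set \<Rightarrow> ('a \<Rightarrow> 'b::euclidean_space) \<Rightarrow> bool" where
  "Ck_on 0 S f \<longleftrightarrow> continuous_on S f"
| "Ck_on (Suc k) S f \<longleftrightarrow>
     (\<forall>x\<in>S. f differentiable (at x)) \<and>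
     (\<forall>v. Ck_on k S (\<lambda>x. frechet_derivative f (at x) v))"

definition smooth_on :: "'a::euclidean_space set \<Rightarrow> ('a \<Rightarrow> 'b::euclidean_space) \<Rightarrow> bool" where
  "smooth_on S f \<longleftrightarrow> (\<forall>k. Ck_on k S f)"

definition diffeomorphism ::
    "'a::euclidean_space set \<Rightarrow> 'b::euclidean_space set \<Rightarrow> ('a \<Rightarrow> 'b) \<Rightarrow> bool" where
  "diffeomorphism U V \<Phi> \<longleftrightarrow>
     bij_betw \<Phi> U V \<and> smooth_on U \<Phi> \<and> smooth_on V (inv_into U \<Phi>)"

text \<open>
  A 1-form on the plane is a function taking a point \<open>p\<close> and a tangent vector at \<open>p\<close> to a real.
  \<open>ode_form f\<close> is \<open>dx - f(x) dt\<close>, points being \<open>(t, x)\<close> and tangent vectors \<open>(dt, dx)\<close>.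
\<close>

type_synonym plane = "real \<times> real"

definition ode_form :: "(real \<Rightarrow> real) \<Rightarrow> plane \<Rightarrow> plane \<Rightarrow> real" where
  "ode_form f p v = snd v - f (snd p) * fst v"

definition pullback ::
    "(plane \<Rightarrow> plane) \<Rightarrow> (plane \<Rightarrow> plane \<Rightarrow> real) \<Rightarrow> plane \<Rightarrow> plane \<Rightarrow> real" where
  "pullback \<Phi> \<omega> p v = \<omega> (\<Phi> p) (frechet_derivative \<Phi> (at p) v)"

text \<open>
  Web equivalence from \<open>dx/dt = f(x)\<close> on \<open>U\<close> to \<open>dX/dT = F(X)\<close> on \<open>V\<close>. Since \<open>U\<close> is open, so are
  its projections \<open>fst ` U\<close> and \<open>snd ` U\<close>, the domains of \<open>\<phi>0\<close> and \<open>\<phi>1\<close>.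
\<close>

definition web_equivalence ::
    "real set \<Rightarrow> (real \<Rightarrow> real) \<Rightarrow> plane set \<Rightarrow>
     real set \<Rightarrow> (real \<Rightarrow> real) \<Rightarrow> plane set \<Rightarrow> (plane \<Rightarrow> plane) \<Rightarrow> bool" where
  "web_equivalence I f U J F V \<Phi> \<longleftrightarrow>
     open U \<and> U \<subseteq> UNIV \<times> I \<and> open V \<and> V \<subseteq> UNIV \<times> J \<and>
     diffeomorphism U V \<Phi> \<and>
     (\<exists>\<phi>0 \<phi>1. smooth_on (fst ` U) \<phi>0 \<and> smooth_on (snd ` U) \<phi>1 \<and>
        (\<forall>(t, x)\<in>U. \<Phi> (t, x) = (\<phi>0 t, \<phi>1 x))) \<and>
     (\<exists>a. smooth_on U a \<and> (\<forall>p\<in>U. a p \<noteq> 0) \<and>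
        (\<forall>p\<in>U. \<forall>v. pullback \<Phi> (ode_form F) p v = a p * ode_form f p v))"

end

theory Submission
  imports Defs
begin

text \<open>
  An autonomous equation \<open>dx/dt = f x\<close> with \<open>f\<close> nowhere zero can be solved by separating variables:
  near \<open>x0\<close> the elapsed time \<open>h x = (integral from x0 to x of 1 / f)\<close> is a smooth local coordinate in
  which the equation reads \<open>dh/dt = 1\<close> (lemma \<open>rectifying_coordinate\<close>). So every such equation has
  the same normal form. If \<open>H\<close> is the elapsed time of \<open>dX/dT = F X\<close> from \<open>X0\<close>, the change of
  variables that equates the two coordinates and translates the time,
  \<open>(t, x) \<mapsto> (t - t0 + T0, inverse H (h x))\<close>, takes solutions to solutions. Concretely
  \<open>\<phi> = inverse H \<circ> h\<close> satisfies \<open>\<phi>' = (F \<circ> \<phi>) / f\<close>, whence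
  \<open>\<phi>' dx - F \<phi> dt = ((F \<circ> \<phi>) / f) (dx - f dt)\<close>, which also exhibits the multiplier.

  Most of the work is the smoothness of these maps, for which the usual closure properties of
  \<open>C^k\<close> functions are developed, up to the chain rule \<open>Ck_on_compose\<close>. The inverse of \<open>h\<close> is smooth by
  bootstrapping: it solves \<open>\<gamma>' = f \<circ> \<gamma>\<close>, so \<open>\<gamma>\<close> of class \<open>C^k\<close> is of class \<open>C^(k+1)\<close>.
\<close>

section \<open>Calculus of continuously differentiable functions\<close>

lemma Ck_on_Suc_has_derivative:
  assumes "Ck_on (Suc k) S f" "x \<in> S"
  shows "(f has_derivative frechet_derivative f (at x)) (at x)"
  using assms by (simp add: frechet_derivative_works)

lemma Ck_on_cong:
  assumes "open S" "\<And>x. x \<in> S \<Longrightarrow> f x = g x"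
  shows "Ck_on k S f \<longleftrightarrow> Ck_on k S g"
  using assms(2)
proof (induction k arbitrary: f g)
  case 0
  then show ?case by (auto cong: continuous_on_cong)
next
  case (Suc k)
  have deriv: "(f has_derivative D) (at x) \<longleftrightarrow> (g has_derivative D) (at x)" if "x \<in> S" for x D
    using has_derivative_transform_within_open[OF _ \<open>open S\<close> that] Suc.prems by metis
  then have "frechet_derivative f (at x) = frechet_derivative g (at x)" if "x \<in> S" for x
    using that by (simp add: frechet_derivative_def)
  then have "Ck_on k S (\<lambda>x. frechet_derivative f (at x) v)
      \<longleftrightarrow> Ck_on k S (\<lambda>x. frechet_derivative g (at x) v)" for v
    by (intro Suc.IH) simp
  moreover have "f differentiable (at x) \<longleftrightarrow> g differentiable (at x)" if "x \<in> S" for x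
    using deriv[OF that] by (simp add: differentiable_def)
  ultimately show ?case by simp
qed

lemma Ck_on_SucI:
  assumes "open S" "\<And>x. x \<in> S \<Longrightarrow> (f has_derivative f' x) (at x)"
    and "\<And>v. Ck_on k S (\<lambda>x. f' x v)"
  shows "Ck_on (Suc k) S f"
proof -
  have "frechet_derivative f (at x) = f' x" if "x \<in> S" for x
    using frechet_derivative_at[OF assms(2)[OF that]] by simp
  then have "Ck_on k S (\<lambda>x. frechet_derivative f (at x) v)" for v
    using Ck_on_cong[OF \<open>open S\<close>, of "\<lambda>x. frechet_derivative f (at x) v" "\<lambda>x. f' x v"] assms(3)
    by simp
  then show ?thesis
    using assms(2) by (auto simp: differentiable_def)
qed

lemma Ck_on_lower: "Ck_on (Suc k) S f \<Longrightarrow> Ck_on k S f"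
proof (induction k arbitrary: f)
  case 0
  then show ?case
    by (auto intro!: continuous_at_imp_continuous_on differentiable_imp_continuous_within)
next
  case (Suc k)
  then show ?case using Ck_on.simps(2) by metis
qed

lemma Ck_on_subset: "Ck_on k S f \<Longrightarrow> T \<subseteq> S \<Longrightarrow> Ck_on k T f"
  by (induction k arbitrary: f) (auto intro: continuous_on_subset)

lemma Ck_on_const: "open S \<Longrightarrow> Ck_on k S (\<lambda>x. c)"
proof (induction k arbitrary: c)
  case (Suc k)
  show ?case by (rule Ck_on_SucI[where f' = "\<lambda>_ _. 0"]) (use Suc in auto)
qed simp

lemma Ck_on_add:
  "open S \<Longrightarrow> Ck_on k S f \<Longrightarrow> Ck_on k S g \<Longrightarrow> Ck_on k S (\<lambda>x. f x + g x)"
proof (induction k arbitrary: f g)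
  case (Suc k)
  show ?case
    by (rule Ck_on_SucI[OF \<open>open S\<close> has_derivative_add])
       (use Suc in \<open>auto intro: Ck_on_Suc_has_derivative\<close>)
qed (simp add: continuous_on_add)

lemma Ck_on_sum:
  assumes "open S" "\<And>i. i \<in> A \<Longrightarrow> Ck_on k S (f i)"
  shows "Ck_on k S (\<lambda>x. \<Sum>i\<in>A. f i x)"
  using assms(2)
  by (induction A rule: infinite_finite_induct)
     (auto intro: Ck_on_const[OF \<open>open S\<close>] Ck_on_add[OF \<open>open S\<close>])

lemma Ck_on_linear:
  assumes "bounded_linear L" "open S"
  shows "Ck_on k S f \<Longrightarrow> Ck_on k S (\<lambda>x. L (f x))"
proof (induction k arbitrary: f)
  case 0
  then show ?case by (simp add: bounded_linear.continuous_on[OF assms(1)])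
next
  case (Suc k)
  show ?case
    by (rule Ck_on_SucI[OF \<open>open S\<close> bounded_linear.has_derivative[OF assms(1)]])
       (use Suc in \<open>auto intro: Ck_on_Suc_has_derivative\<close>)
qed

lemma Ck_on_bilinear:
  assumes "bounded_bilinear P" "open S"
  shows "Ck_on k S f \<Longrightarrow> Ck_on k S g \<Longrightarrow> Ck_on k S (\<lambda>x. P (f x) (g x))"
proof (induction k arbitrary: f g)
  case 0
  then show ?case by (simp add: bounded_bilinear.continuous_on[OF assms(1)])
next
  case (Suc k)
  show ?case
  proof (rule Ck_on_SucI[OF \<open>open S\<close> bounded_bilinear.FDERIV[OF assms(1)]])
    fix v
    show "Ck_on k S (\<lambda>x. P (f x) (frechet_derivative g (at x) v)
                       + P (frechet_derivative f (at x) v) (g x))"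
      using Suc.prems Ck_on_lower[OF Suc.prems(1)] Ck_on_lower[OF Suc.prems(2)]
      by (intro Ck_on_add \<open>open S\<close> Suc.IH) auto
  qed (use Suc.prems in \<open>auto intro: Ck_on_Suc_has_derivative\<close>)
qed

text \<open>
  Only directional derivatives are at hand, so the chain rule \<open>D(g \<circ> f) v = Dg (Df v)\<close>, whose
  direction \<open>Df v\<close> depends on the point, has to be expanded in a basis before induction applies.
\<close>

lemma Ck_on_compose:
  fixes f :: "'a::euclidean_space \<Rightarrow> 'b::euclidean_space"
    and g :: "'b \<Rightarrow> 'c::euclidean_space"
  assumes "open S" "open T" "f ` S \<subseteq> T"
  shows "Ck_on k T g \<Longrightarrow> Ck_on k S f \<Longrightarrow> Ck_on k S (\<lambda>x. g (f x))"
  using assms(3)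
proof (induction k arbitrary: f g)
  case 0
  then show ?case by (auto intro: continuous_on_compose2)
next
  case (Suc k)
  let ?f' = "\<lambda>x. frechet_derivative f (at x)" and ?g' = "\<lambda>y. frechet_derivative g (at y)"
  show ?case
  proof (rule Ck_on_SucI[OF \<open>open S\<close>])
    fix x assume x: "x \<in> S"
    then have f: "(f has_derivative ?f' x) (at x)"
      using Suc.prems(2) by (rule Ck_on_Suc_has_derivative[rotated])
    have g: "(g has_derivative ?g' (f x)) (at (f x))"
      using Suc.prems(1,3) x by (intro Ck_on_Suc_has_derivative) auto
    interpret g': bounded_linear "?g' (f x)"
      using g by (rule has_derivative_bounded_linear)
    have "?g' (f x) (?f' x v) = (\<Sum>b\<in>Basis. (?f' x v \<bullet> b) *\<^sub>R ?g' (f x) b)" for v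
      by (subst euclidean_representation[of "?f' x v", symmetric]) (simp add: g'.sum g'.scaleR)
    then show "((\<lambda>x. g (f x)) has_derivative
        (\<lambda>v. \<Sum>b\<in>Basis. (?f' x v \<bullet> b) *\<^sub>R ?g' (f x) b)) (at x)"
      using has_derivative_compose[OF f g] by simp
  next
    fix v
    have "Ck_on k S (\<lambda>x. ?g' (f x) b)" for b
      using Suc.prems(1,3) Ck_on_lower[OF Suc.prems(2)] by (intro Suc.IH) auto
    moreover have "Ck_on k S (\<lambda>x. ?f' x v \<bullet> b)" for b
      using Suc.prems by (intro Ck_on_linear[OF bounded_linear_inner_left \<open>open S\<close>]) auto
    ultimately show "Ck_on k S (\<lambda>x. \<Sum>b\<in>Basis. (?f' x v \<bullet> b) *\<^sub>R ?g' (f x) b)"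
      by (intro Ck_on_sum Ck_on_bilinear[OF bounded_bilinear_scaleR] \<open>open S\<close>)
  qed
qed

lemma Ck_on_real_SucI:
  fixes f f' :: "real \<Rightarrow> real"
  assumes "open S" "\<And>x. x \<in> S \<Longrightarrow> (f has_real_derivative f' x) (at x)" "Ck_on k S f'"
  shows "Ck_on (Suc k) S f"
proof (rule Ck_on_SucI[OF \<open>open S\<close>])
  fix x assume "x \<in> S"
  then show "(f has_derivative (\<lambda>v. f' x * v)) (at x)"
    using assms(2) by (simp add: has_field_derivative_def)
next
  fix v
  show "Ck_on k S (\<lambda>x. f' x * v)"
    by (intro Ck_on_linear[OF bounded_linear_mult_left] assms)
qed

lemma Ck_on_id: "open S \<Longrightarrow> Ck_on k S (\<lambda>x. x)"
proof (cases k)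
  case (Suc n)
  assume "open S"
  then show ?thesis
    unfolding Suc by (intro Ck_on_SucI[OF _ has_derivative_ident] Ck_on_const)
qed simp

lemma Ck_on_reciprocal: "Ck_on k (- {0}) (inverse :: real \<Rightarrow> real)"
proof (induction k)
  case 0
  then show ?case by (auto intro!: continuous_intros)
next
  case (Suc k)
  have "Ck_on k (- {0}) (\<lambda>x::real. - (inverse x * inverse x))"
    by (intro Ck_on_linear[OF bounded_linear_minus[OF bounded_linear_ident]]
          Ck_on_bilinear[OF bounded_bilinear_mult] Suc open_Compl) auto
  then show ?case
    by (rule Ck_on_real_SucI[rotated 2]) (auto intro!: derivative_eq_intros)
qed

section \<open>Smooth functions\<close>

lemma smooth_on_cong:
  "open S \<Longrightarrow> (\<And>x. x \<in> S \<Longrightarrow> f x = g x) \<Longrightarrow> smooth_on S f \<longleftrightarrow> smooth_on S g"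
  unfolding smooth_on_def using Ck_on_cong by metis

lemma smooth_on_subset: "smooth_on S f \<Longrightarrow> T \<subseteq> S \<Longrightarrow> smooth_on T f"
  unfolding smooth_on_def using Ck_on_subset by blast

lemma smooth_on_imp_continuous_on: "smooth_on S f \<Longrightarrow> continuous_on S f"
  unfolding smooth_on_def by (metis Ck_on.simps(1))

lemma smooth_on_compose:
  "smooth_on T g \<Longrightarrow> smooth_on S f \<Longrightarrow> open S \<Longrightarrow> open T \<Longrightarrow> f ` S \<subseteq> T
    \<Longrightarrow> smooth_on S (\<lambda>x. g (f x))"
  unfolding smooth_on_def using Ck_on_compose by blast

lemma smooth_on_linear: "bounded_linear L \<Longrightarrow> open S \<Longrightarrow> smooth_on S L"
  unfolding smooth_on_def using Ck_on_linear[OF _ _ Ck_on_id] by blast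

lemma smooth_on_translation: "open S \<Longrightarrow> smooth_on S (\<lambda>x. x - a + b)"
  using Ck_on_add[OF _ Ck_on_id Ck_on_const[where c = "b - a"]]
  by (simp add: smooth_on_def algebra_simps)

lemma smooth_on_Pair:
  assumes "open S" "smooth_on S f" "smooth_on S g"
  shows "smooth_on S (\<lambda>x. (f x, g x))"
  unfolding smooth_on_def
proof
  fix k
  have "Ck_on k S (\<lambda>x. (f x, 0) + (0, g x))"
    using assms unfolding smooth_on_def
    by (intro Ck_on_add Ck_on_linear[of "\<lambda>y. (y, 0)"] Ck_on_linear[of "\<lambda>y. (0, y)"]
          bounded_linear_Pair bounded_linear_ident bounded_linear_zero) auto
  then show "Ck_on k S (\<lambda>x. (f x, g x))" by simp
qed

lemma smooth_on_reciprocal: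
  fixes f :: "'a::euclidean_space \<Rightarrow> real"
  assumes "open S" "smooth_on S f" "\<And>x. x \<in> S \<Longrightarrow> f x \<noteq> 0"
  shows "smooth_on S (\<lambda>x. inverse (f x))"
  by (rule smooth_on_compose[of "- {0}" inverse])
     (use assms Ck_on_reciprocal in \<open>auto simp: smooth_on_def open_Compl\<close>)

lemma smooth_on_divide:
  fixes f g :: "'a::euclidean_space \<Rightarrow> real"
  assumes "open S" "smooth_on S f" "smooth_on S g" "\<And>x. x \<in> S \<Longrightarrow> g x \<noteq> 0"
  shows "smooth_on S (\<lambda>x. f x / g x)"
  using Ck_on_bilinear[OF bounded_bilinear_mult \<open>open S\<close>, of _ f "\<lambda>x. inverse (g x)"]
    assms smooth_on_reciprocal[of S g]
  by (simp add: smooth_on_def divide_inverse)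

lemma smooth_on_real_antiderivative:
  fixes f f' :: "real \<Rightarrow> real"
  assumes "open S" "\<And>x. x \<in> S \<Longrightarrow> (f has_real_derivative f' x) (at x)" "smooth_on S f'"
  shows "smooth_on S f"
  using Ck_on_lower[OF Ck_on_real_SucI[OF assms(1,2)]] assms(3) unfolding smooth_on_def by blast

text \<open>
  With \<open>f\<close> smooth, the derivative \<open>f \<circ> \<gamma>\<close> is as regular as \<open>\<gamma>\<close> itself, so continuity of \<open>\<gamma>\<close>
  bootstraps to every order.
\<close>

lemma smooth_on_autonomous_solution:
  fixes f \<gamma> :: "real \<Rightarrow> real"
  assumes "open W" "open I" "smooth_on I f" "\<gamma> ` W \<subseteq> I"
    and \<gamma>: "\<And>w. w \<in> W \<Longrightarrow> (\<gamma> has_real_derivative f (\<gamma> w)) (at w)"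
  shows "smooth_on W \<gamma>"
  unfolding smooth_on_def
proof
  fix k
  show "Ck_on k W \<gamma>"
  proof (induction k)
    case 0
    have "continuous_on W \<gamma>"
      using \<gamma> by (blast intro: DERIV_isCont continuous_at_imp_continuous_on)
    then show ?case by simp
  next
    case (Suc k)
    have "Ck_on k I f" using assms(3) by (simp add: smooth_on_def)
    then have "Ck_on k W (\<lambda>w. f (\<gamma> w))"
      using Suc by (rule Ck_on_compose[OF assms(1,2,4)])
    with \<gamma> show ?case by (rule Ck_on_real_SucI[OF \<open>open W\<close>])
  qed
qed

section \<open>Rectification and web equivalence\<close>

text \<open>
  The coordinate \<open>h\<close> measures the time a solution of \<open>dx/dt = f x\<close> needs from \<open>x0\<close> to \<open>x\<close>, and its
  inverse \<open>\<gamma>\<close> is the solution starting at \<open>x0\<close>. Injectivity of \<open>h\<close> is Rolle's theorem applied to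
  \<open>h' = 1 / f \<noteq> 0\<close>.
\<close>

lemma rectifying_coordinate:
  fixes f :: "real \<Rightarrow> real"
  assumes "open I" "x0 \<in> I" "smooth_on I f" and nz: "\<forall>x\<in>I. f x \<noteq> 0"
  obtains A W h \<gamma> where "open A" "x0 \<in> A" "A \<subseteq> I" "open W" "h x0 = 0" "h ` A = W" "\<gamma> ` W = A"
    "\<And>x. x \<in> A \<Longrightarrow> \<gamma> (h x) = x" "\<And>w. w \<in> W \<Longrightarrow> h (\<gamma> w) = w"
    "\<And>x. x \<in> A \<Longrightarrow> (h has_real_derivative 1 / f x) (at x)"
    "\<And>w. w \<in> W \<Longrightarrow> (\<gamma> has_real_derivative f (\<gamma> w)) (at w)"
    "smooth_on A h" "smooth_on W \<gamma>"
proof -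
  obtain d where "d > 0" and d: "cball x0 d \<subseteq> I"
    using assms(1,2) open_contains_cball by blast
  define A where "A = {x0 - d<..<x0 + d}"
  have sub: "{x0 - d..x0 + d} \<subseteq> I" "A \<subseteq> I"
    using d by (auto simp: A_def cball_eq_atLeastAtMost)
  have A: "open A" "x0 \<in> A" using \<open>d > 0\<close> by (auto simp: A_def)
  have "continuous_on {x0 - d..x0 + d} (\<lambda>x. 1 / f x)"
    using continuous_on_subset[OF smooth_on_imp_continuous_on[OF assms(3)] sub(1)] sub(1) nz
    by (auto intro!: continuous_intros)
  then obtain g where
    g: "\<And>x. x \<in> {x0 - d..x0 + d} \<Longrightarrow> (g has_vector_derivative 1 / f x) (at x within {x0 - d..x0 + d})"
    by (rule antiderivative_continuous) blast
  define h where "h x = g x - g x0" for x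
  have h: "(h has_real_derivative 1 / f x) (at x)" if "x \<in> A" for x
  proof -
    have "x \<in> interior {x0 - d..x0 + d}"
      using that by (simp add: A_def interior_atLeastAtMost_real)
    then have "(g has_real_derivative 1 / f x) (at x)"
      using g[of x] that at_within_interior[of x "{x0 - d..x0 + d}"]
      by (auto simp: A_def has_real_derivative_iff_has_vector_derivative)
    then show ?thesis unfolding h_def by (auto intro!: derivative_eq_intros)
  qed
  have conth: "continuous_on A h"
    using h by (blast intro: DERIV_isCont continuous_at_imp_continuous_on)
  have no_return: "h x \<noteq> h y" if "x \<in> A" "y \<in> A" "x < y" for x y
  proof
    assume eq: "h x = h y"
    have xy: "{x..y} \<subseteq> A" using that by (auto simp: A_def)
    obtain z where z: "x < z" "z < y" "(h has_real_derivative 0) (at z)"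
      using Rolle[OF \<open>x < y\<close> eq continuous_on_subset[OF conth xy]] h xy
      by (metis atLeastAtMost_iff less_imp_le real_differentiable_def subsetD)
    then have "z \<in> A" using xy by auto
    then show False
      using DERIV_unique[OF z(3) h] nz sub by auto
  qed
  then have inj: "inj_on h A"
    by (metis inj_onI linorder_neqE)
  define W where "W = h ` A"
  define \<gamma> where "\<gamma> = inv_into A h"
  have W: "open W" unfolding W_def by (rule invariance_of_domain[OF conth A(1) inj])
  have \<gamma>h: "\<gamma> (h x) = x" if "x \<in> A" for x using that inj by (simp add: \<gamma>_def)
  have h\<gamma>: "h (\<gamma> w) = w" if "w \<in> W" for w using that by (simp add: \<gamma>_def W_def f_inv_into_f)
  have \<gamma>W: "\<gamma> ` W = A" using \<gamma>h by (force simp: W_def)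
  have \<gamma>: "(\<gamma> has_real_derivative f (\<gamma> w)) (at w)" if "w \<in> W" for w
  proof -
    have "\<gamma> w \<in> A" using \<gamma>W that by blast
    then have "f (\<gamma> w) \<noteq> 0" using nz sub(2) by blast
    then have "(*) (1 / f (\<gamma> w)) \<circ> (*) (f (\<gamma> w)) = id"
      by (simp add: fun_eq_iff)
    then show ?thesis
      using has_derivative_inverse_strong_x[OF A(1) \<open>\<gamma> w \<in> A\<close> conth \<gamma>h] h[OF \<open>\<gamma> w \<in> A\<close>] h\<gamma>[OF that]
      unfolding has_field_derivative_def by blast
  qed
  have "smooth_on A (\<lambda>x. inverse (f x))"
    using assms sub nz by (intro smooth_on_reciprocal A(1) smooth_on_subset[OF assms(3)]) auto
  then have sh: "smooth_on A h"
    using smooth_on_real_antiderivative[OF A(1) h] by (simp add: divide_inverse)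
  have s\<gamma>: "smooth_on W \<gamma>"
    using smooth_on_autonomous_solution[OF W assms(1,3) _ \<gamma>] \<gamma>W sub(2) by blast
  have h0: "h x0 = 0" by (simp add: h_def)
  show ?thesis
    by (rule that[OF A sub(2) W h0 W_def[symmetric] \<gamma>W \<gamma>h h\<gamma> h \<gamma> sh s\<gamma>])
qed

lemma smooth_on_times_map:
  assumes "open A" "open B" "smooth_on A p" "smooth_on B q"
  shows "smooth_on (A \<times> B) (\<lambda>z. (p (fst z), q (snd z)))"
proof (rule smooth_on_Pair)
  show AB: "open (A \<times> B)" using assms by (simp add: open_Times)
  show "smooth_on (A \<times> B) (\<lambda>z. p (fst z))"
    by (rule smooth_on_compose[OF assms(3) smooth_on_linear[OF bounded_linear_fst AB] AB assms(1)])
       auto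
  show "smooth_on (A \<times> B) (\<lambda>z. q (snd z))"
    by (rule smooth_on_compose[OF assms(4) smooth_on_linear[OF bounded_linear_snd AB] AB assms(2)])
       auto
qed

text \<open>
  The relation \<open>\<phi>' = (F \<circ> \<phi>) / f\<close> says that \<open>\<phi>\<close> carries solutions to solutions at unchanged speed,
  so it may be paired with a translation of the time.
\<close>

lemma web_equivalence_of_conjugacy:
  fixes f F \<phi> \<psi> :: "real \<Rightarrow> real"
  assumes A: "open A" "A \<subseteq> I" and B: "open B" "B \<subseteq> J"
    and f: "smooth_on I f" "\<And>x. x \<in> I \<Longrightarrow> f x \<noteq> 0"
    and F: "smooth_on J F" "\<And>x. x \<in> J \<Longrightarrow> F x \<noteq> 0"
    and \<phi>: "smooth_on A \<phi>" "\<And>x. x \<in> A \<Longrightarrow> \<phi> x \<in> B" "\<And>x. x \<in> A \<Longrightarrow> \<psi> (\<phi> x) = x"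
    and \<psi>: "smooth_on B \<psi>" "\<And>y. y \<in> B \<Longrightarrow> \<psi> y \<in> A" "\<And>y. y \<in> B \<Longrightarrow> \<phi> (\<psi> y) = y"
    and \<phi>': "\<And>x. x \<in> A \<Longrightarrow> (\<phi> has_real_derivative F (\<phi> x) / f x) (at x)"
  shows "web_equivalence I f (UNIV \<times> A) J F (UNIV \<times> B) (\<lambda>(t, x). (t - t0 + T0, \<phi> x))"
proof -
  let ?U = "(UNIV :: real set) \<times> A" and ?V = "(UNIV :: real set) \<times> B"
  define \<Phi> where "\<Phi> = (\<lambda>z :: plane. (fst z - t0 + T0, \<phi> (snd z)))"
  define \<Psi> where "\<Psi> = (\<lambda>z :: plane. (fst z - T0 + t0, \<psi> (snd z)))"
  define a where "a = (\<lambda>x. F (\<phi> x) / f x)"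
  have open_UV: "open ?U" "open ?V" using A B by (auto intro: open_Times)

  have inv: "\<Psi> (\<Phi> z) = z" "\<Phi> z \<in> ?V" if "z \<in> ?U" for z
    using that \<phi> by (auto simp: \<Phi>_def \<Psi>_def)
  have inv': "\<Phi> (\<Psi> z) = z" "\<Psi> z \<in> ?U" if "z \<in> ?V" for z
    using that \<psi> by (auto simp: \<Phi>_def \<Psi>_def)
  have bij: "bij_betw \<Phi> ?U ?V"
    by (rule bij_betw_byWitness[where f' = \<Psi>]) (use inv inv' in blast)+
  have "inv_into ?U \<Phi> z = \<Psi> z" if "z \<in> ?V" for z
    using bij inv'[OF that] by (metis bij_betw_imp_inj_on inv_into_f_f)
  moreover have "smooth_on ?U \<Phi>" "smooth_on ?V \<Psi>"
    unfolding \<Phi>_def \<Psi>_def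
    by (intro smooth_on_times_map smooth_on_translation open_UNIV A(1) B(1) \<phi>(1) \<psi>(1))+
  ultimately have diffeo: "diffeomorphism ?U ?V \<Phi>"
    unfolding diffeomorphism_def using bij smooth_on_cong[OF open_UV(2)] by metis

  have product: "\<exists>\<phi>0 \<phi>1. smooth_on (fst ` ?U) \<phi>0 \<and> smooth_on (snd ` ?U) \<phi>1 \<and>
      (\<forall>(t, x)\<in>?U. \<Phi> (t, x) = (\<phi>0 t, \<phi>1 x))"
  proof (intro exI conjI)
    show "smooth_on (fst ` ?U) (\<lambda>t. t - t0 + T0)"
      by (intro smooth_on_translation open_image_fst open_UV)
    show "smooth_on (snd ` ?U) \<phi>"
      using \<phi>(1) by simp
  qed (simp add: \<Phi>_def)

  have "smooth_on A (\<lambda>x. F (\<phi> x))"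
    by (rule smooth_on_compose[OF smooth_on_subset[OF F(1) B(2)] \<phi>(1) A(1) B(1)])
       (use \<phi>(2) in blast)
  then have "smooth_on A a"
    unfolding a_def using A f by (intro smooth_on_divide smooth_on_subset[OF f(1)]) auto
  then have "smooth_on ?U (\<lambda>z. a (snd z))"
    by (rule smooth_on_compose[OF _ smooth_on_linear[OF bounded_linear_snd]])
       (use A(1) open_UV in auto)
  moreover have "a (snd z) \<noteq> 0" if "z \<in> ?U" for z
    using that A(2) B(2) f(2) F(2) \<phi>(2) by (auto simp: a_def subset_iff)
  moreover have "pullback \<Phi> (ode_form F) z v = a (snd z) * ode_form f z v" if z: "z \<in> ?U" for z v
  proof -
    have "snd z \<in> A" using z by auto
    then have "(\<phi> has_derivative (*) (a (snd z))) (at (snd z))"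
      using \<phi>' by (simp add: a_def has_field_derivative_def)
    then have "((\<lambda>z. \<phi> (snd z)) has_derivative (\<lambda>v. a (snd z) * snd v)) (at z)"
      by (rule has_derivative_compose[OF has_derivative_snd[OF has_derivative_ident]])
    then have "(\<Phi> has_derivative (\<lambda>v. (fst v, a (snd z) * snd v))) (at z)"
      unfolding \<Phi>_def by (auto intro!: derivative_eq_intros)
    then have "frechet_derivative \<Phi> (at z) = (\<lambda>v. (fst v, a (snd z) * snd v))"
      using frechet_derivative_at by metis
    moreover have "F (\<phi> (snd z)) = a (snd z) * f (snd z)"
      using \<open>snd z \<in> A\<close> A(2) f(2) by (auto simp: a_def)
    ultimately show ?thesis
      by (simp add: pullback_def ode_form_def \<Phi>_def algebra_simps)
  qed
  ultimately have multiplier: "\<exists>a. smooth_on ?U a \<and> (\<forall>p\<in>?U. a p \<noteq> 0) \<and>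
      (\<forall>p\<in>?U. \<forall>v. pullback \<Phi> (ode_form F) p v = a p * ode_form f p v)"
    by blast
  have "web_equivalence I f ?U J F ?V \<Phi>"
    unfolding web_equivalence_def
    using open_UV A(2) B(2) diffeo product multiplier by blast
  then show ?thesis
    by (simp add: \<Phi>_def case_prod_unfold)
qed

theorem mainTheorem2:
  fixes I J :: "real set" and f F :: "real \<Rightarrow> real" and t0 x0 T0 X0 :: real
  assumes "open I" and "is_interval I" and "open J" and "is_interval J"
    and "smooth_on I f" and "\<forall>x\<in>I. f x \<noteq> 0"
    and "smooth_on J F" and "\<forall>X\<in>J. F X \<noteq> 0"
    and "(t0, x0) \<in> UNIV \<times> I" and "(T0, X0) \<in> UNIV \<times> J"
  shows "\<exists>U V \<Phi>. (t0, x0) \<in> U \<and> (T0, X0) \<in> V \<and>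
           web_equivalence I f U J F V \<Phi> \<and> \<Phi> (t0, x0) = (T0, X0)"
proof -
  have x0: "x0 \<in> I" and X0: "X0 \<in> J" using assms(9,10) by auto
  obtain A1 W1 h \<gamma> where A1: "open A1" "x0 \<in> A1" "A1 \<subseteq> I" and W1: "open W1"
    and h0: "h x0 = 0" and im: "h ` A1 = W1" "\<gamma> ` W1 = A1"
    and \<gamma>h: "\<And>x. x \<in> A1 \<Longrightarrow> \<gamma> (h x) = x" and h\<gamma>: "\<And>w. w \<in> W1 \<Longrightarrow> h (\<gamma> w) = w"
    and h': "\<And>x. x \<in> A1 \<Longrightarrow> (h has_real_derivative 1 / f x) (at x)"
    and "\<And>w. w \<in> W1 \<Longrightarrow> (\<gamma> has_real_derivative f (\<gamma> w)) (at w)"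
    and smooth_h: "smooth_on A1 h" and smooth_\<gamma>: "smooth_on W1 \<gamma>"
    by (rule rectifying_coordinate[OF assms(1) x0 assms(5) assms(6)]) (rule that)
  obtain A2 W2 H \<Gamma> where A2: "open A2" "X0 \<in> A2" "A2 \<subseteq> J" and W2: "open W2"
    and H0: "H X0 = 0" and IM: "H ` A2 = W2" "\<Gamma> ` W2 = A2"
    and \<Gamma>H: "\<And>X. X \<in> A2 \<Longrightarrow> \<Gamma> (H X) = X" and H\<Gamma>: "\<And>w. w \<in> W2 \<Longrightarrow> H (\<Gamma> w) = w"
    and "\<And>X. X \<in> A2 \<Longrightarrow> (H has_real_derivative 1 / F X) (at X)"
    and \<Gamma>': "\<And>w. w \<in> W2 \<Longrightarrow> (\<Gamma> has_real_derivative F (\<Gamma> w)) (at w)"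
    and smooth_H: "smooth_on A2 H" and smooth_\<Gamma>: "smooth_on W2 \<Gamma>"
    by (rule rectifying_coordinate[OF assms(3) X0 assms(7) assms(8)]) (rule that)
  \<comment> \<open>The two time coordinates have different ranges, so both sides are cut down to the common one.\<close>
  define A where "A = A1 \<inter> h -` W2"
  define B where "B = A2 \<inter> H -` W1"
  define \<phi> where "\<phi> = (\<lambda>x. \<Gamma> (h x))"
  define \<psi> where "\<psi> = (\<lambda>X. \<gamma> (H X))"
  have AB: "open A" "A \<subseteq> I" "open B" "B \<subseteq> J"
    using A1 A2 W1 W2 smooth_on_imp_continuous_on[OF smooth_h] smooth_on_imp_continuous_on[OF smooth_H]
    unfolding A_def B_def by (auto intro: continuous_open_preimage)
  have "0 \<in> W1" "0 \<in> W2" using A1(2) A2(2) h0 H0 im IM by force+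
  then have base: "x0 \<in> A" "X0 \<in> B" "\<phi> x0 = X0"
    using A1(2) A2(2) h0 H0 \<Gamma>H[of X0] \<open>0 \<in> W1\<close> \<open>0 \<in> W2\<close> by (auto simp: A_def B_def \<phi>_def)
  have \<phi>: "\<phi> x \<in> B" "\<psi> (\<phi> x) = x" if "x \<in> A" for x
    using that im IM \<gamma>h H\<Gamma> by (auto simp: A_def B_def \<phi>_def \<psi>_def)
  have \<psi>: "\<psi> X \<in> A" "\<phi> (\<psi> X) = X" if "X \<in> B" for X
    using that im IM \<Gamma>H h\<gamma> by (auto simp: A_def B_def \<phi>_def \<psi>_def)
  have smooth: "smooth_on A \<phi>" "smooth_on B \<psi>"
    unfolding \<phi>_def \<psi>_def
    by (rule smooth_on_compose[OF smooth_\<Gamma> smooth_on_subset[OF smooth_h]]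
          smooth_on_compose[OF smooth_\<gamma> smooth_on_subset[OF smooth_H]];
        use AB W1 W2 in \<open>auto simp: A_def B_def\<close>)+
  have "(\<phi> has_real_derivative F (\<phi> x) / f x) (at x)" if "x \<in> A" for x
    using DERIV_chain2[OF \<Gamma>'[of "h x"] h'[of x]] that
    by (simp add: A_def \<phi>_def)
  then have "web_equivalence I f (UNIV \<times> A) J F (UNIV \<times> B) (\<lambda>(t, x). (t - t0 + T0, \<phi> x))"
    using AB assms(5-8) \<phi> \<psi> smooth by (intro web_equivalence_of_conjugacy) auto
  with base show ?thesis
    by (intro exI[of _ "UNIV \<times> A"] exI[of _ "UNIV \<times> B"]
          exI[of _ "\<lambda>(t, x). (t - t0 + T0, \<phi> x)"] conjI) simp_all
qed

end
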